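(* Let $X$ and $Y$ be L-algebras such that $Y$ operates on $X$ via $\rho:Y\to\mathrm{End}(X)$, and let $\tilde\rho: S(Y)\to\mathrm{End}(S(X))$ be the operation of $S(Y)$ on $S(X)$ extending $\rho$. Then $$S(X\rtimes_\rho Y)=S(X)\rtimes_{\tilde\rho}S(Y),$$ that is, $S(X)\rtimes_{\tilde\rho}S(Y)$, with $X\rtimes_\rho Y$ embedded in it as the subset $X\times Y$, is the self-similar closure of $X\rtimes_\rho Y$.
   Context: An L-algebra is a set $X$ with a binary operation $\cdot$ and a distinguished element $1$ such that for all $x,y,z\in X$: $1\cdot x=x$ and $x\cdot 1=x\cdot x=1$; $(x\cdot y)\cdot(x\cdot z)=(y\cdot x)\cdot(y\cdot z)$; and $x\cdot y=y\cdot x=1$ implies $x=y$. It is partially ordered by $x\le y\iff x\cdot y=1$. $\mathrm{End}(X)$ is the set of maps $f:X\to X$ with $f(x\cdot y)=f(x)\cdot f(y)$. An L-algebra $Y$ operates on an L-algebra $X$ via $\rho:Y\to\mathrm{End}(X)$, $u\mapsto\rho_u$, if $\rho_1=\mathrm{id}$ and $\rho_{u\cdot v}\circ\rho_u=\rho_{v\cdot u}\circ\rho_v$ for all $u,v\in Y$. The semidirect product $X\rtimes_\rho Y$ is the L-algebra on $X\times Y$ with operation $(x,u)\cdot(y,v)=(\rho_{u\cdot v}(x)\cdot\rho_{v\cdot u}(y),\,u\cdot v)$. An L-algebra $H$ is self-similar if for every $x\in H$ the map $y\mapsto x\cdot y$ restricts to a bijection $\{y\in H: y\le x\}\to H$.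 A self-similar L-algebra is a monoid with unit $1$, where the product $ab$ is the unique $c\le b$ with $b\cdot c=a$. The self-similar closure $S(X)$ of $X$ is a self-similar L-algebra containing $X$ as an L-subalgebra and generated by $X$ as a monoid; it exists and is unique up to isomorphism over $X$. Every L-algebra morphism $X\to H$ with $H$ self-similar extends uniquely to a morphism $S(X)\to H$, which is multiplicative. The operation $\tilde\rho$: for $u\in Y$, $\tilde\rho_u\in\mathrm{End}(S(X))$ is the unique extension of $\rho_u$ to $S(X)$, and $\tilde\rho_{ab}=\tilde\rho_a\circ\tilde\rho_b$ for $a,b\in S(Y)$; this gives a well-defined operation of $S(Y)$ on $S(X)$. *)

theory Defs
  imports "HOL-Algebra.Group"
begin

record 'a lalgebra = "'a partial_object" +
  lop :: "'a \<Rightarrow> 'a \<Rightarrow> 'a" (infixl \<open>\<cdot>\<index>\<close> 70)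
  lone :: 'a (\<open>\<^bold>1\<index>\<close>)

locale l_algebra =
  fixes X :: "('a, 'm) lalgebra_scheme" (structure)
  assumes lop_closed: "x \<in> carrier X \<Longrightarrow> y \<in> carrier X \<Longrightarrow> x \<cdot> y \<in> carrier X"
    and lone_closed: "\<^bold>1 \<in> carrier X"
    and lone_left: "x \<in> carrier X \<Longrightarrow> \<^bold>1 \<cdot> x = x"
    and lone_right: "x \<in> carrier X \<Longrightarrow> x \<cdot> \<^bold>1 = \<^bold>1"
    and lop_self: "x \<in> carrier X \<Longrightarrow> x \<cdot> x = \<^bold>1"
    and cycloid: "x \<in> carrier X \<Longrightarrow> y \<in> carrier X \<Longrightarrow> z \<in> carrier X \<Longrightarrow>
      (x \<cdot> y) \<cdot> (x \<cdot> z) = (y \<cdot> x) \<cdot> (y \<cdot> z)"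
    and lop_antisym: "x \<in> carrier X \<Longrightarrow> y \<in> carrier X \<Longrightarrow>
      x \<cdot> y = \<^bold>1 \<Longrightarrow> y \<cdot> x = \<^bold>1 \<Longrightarrow> x = y"

definition l_le :: "('a, 'm) lalgebra_scheme \<Rightarrow> 'a \<Rightarrow> 'a \<Rightarrow> bool" (infix \<open>\<preceq>\<index>\<close> 50)
  where "x \<preceq>\<^bsub>X\<^esub> y \<longleftrightarrow> x \<cdot>\<^bsub>X\<^esub> y = \<^bold>1\<^bsub>X\<^esub>"

text \<open>Endomorphisms are total functions of which only the values on the carrier matter;
  equality of endomorphisms is therefore stated pointwise on the carrier below.\<close>

definition l_End :: "('a, 'm) lalgebra_scheme \<Rightarrow> ('a \<Rightarrow> 'a) set"
  where "l_End X = {f \<in> carrier X \<rightarrow> carrier X.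
    \<forall>x\<in>carrier X. \<forall>y\<in>carrier X. f (x \<cdot>\<^bsub>X\<^esub> y) = f x \<cdot>\<^bsub>X\<^esub> f y}"

definition operates_on ::
    "('b, 'n) lalgebra_scheme \<Rightarrow> ('a, 'm) lalgebra_scheme \<Rightarrow> ('b \<Rightarrow> 'a \<Rightarrow> 'a) \<Rightarrow> bool"
  where "operates_on Y X \<rho> \<longleftrightarrow>
    \<rho> \<in> carrier Y \<rightarrow> l_End X \<and>
    (\<forall>x\<in>carrier X. \<rho> \<^bold>1\<^bsub>Y\<^esub> x = x) \<and>
    (\<forall>u\<in>carrier Y. \<forall>v\<in>carrier Y. \<forall>x\<in>carrier X.
       \<rho> (u \<cdot>\<^bsub>Y\<^esub> v) (\<rho> u x) = \<rho> (v \<cdot>\<^bsub>Y\<^esub> u) (\<rho> v x))"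

definition semidirect ::
    "('a, 'm) lalgebra_scheme \<Rightarrow> ('b \<Rightarrow> 'a \<Rightarrow> 'a) \<Rightarrow> ('b, 'n) lalgebra_scheme \<Rightarrow> ('a \<times> 'b) lalgebra"
  where "semidirect X \<rho> Y =
    \<lparr>carrier = carrier X \<times> carrier Y,
     lop = (\<lambda>(x, u) (y, v).
       (\<rho> (u \<cdot>\<^bsub>Y\<^esub> v) x \<cdot>\<^bsub>X\<^esub> \<rho> (v \<cdot>\<^bsub>Y\<^esub> u) y, u \<cdot>\<^bsub>Y\<^esub> v)),
     lone = (\<^bold>1\<^bsub>X\<^esub>, \<^bold>1\<^bsub>Y\<^esub>)\<rparr>"

locale self_similar = l_algebra H for H (structure) +
  assumes self_similar_bij:
    "x \<in> carrier H \<Longrightarrow> bij_betw (\<lambda>y. x \<cdot> y) {y \<in> carrier H. y \<preceq> x} (carrier H)"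

text \<open>The monoid of a self-similar L-algebra; the product is well defined by self-similarity.\<close>

definition ss_mult :: "('a, 'm) lalgebra_scheme \<Rightarrow> 'a \<Rightarrow> 'a \<Rightarrow> 'a"
  where "ss_mult H a b = (THE c. c \<in> carrier H \<and> c \<preceq>\<^bsub>H\<^esub> b \<and> b \<cdot>\<^bsub>H\<^esub> c = a)"

definition ss_monoid :: "('a, 'm) lalgebra_scheme \<Rightarrow> 'a monoid"
  where "ss_monoid H = \<lparr>carrier = carrier H, mult = ss_mult H, one = \<^bold>1\<^bsub>H\<^esub>\<rparr>"

definition l_subalgebra :: "('a, 'm) lalgebra_scheme \<Rightarrow> ('a, 'n) lalgebra_scheme \<Rightarrow> bool"
  where "l_subalgebra X S \<longleftrightarrow>
    l_algebra X \<and> l_algebra S \<and> carrier X \<subseteq> carrier S \<and> \<^bold>1\<^bsub>X\<^esub> = \<^bold>1\<^bsub>S\<^esub> \<and>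
    (\<forall>x\<in>carrier X. \<forall>y\<in>carrier X. x \<cdot>\<^bsub>X\<^esub> y = x \<cdot>\<^bsub>S\<^esub> y)"

text \<open>The closure is unique only up to isomorphism over \<open>X\<close>, so being a self-similar closure
  is a predicate; the last conjunct says that \<open>X\<close> generates \<open>S\<close> as a monoid.\<close>

definition self_similar_closure ::
    "('a, 'm) lalgebra_scheme \<Rightarrow> ('a, 'n) lalgebra_scheme \<Rightarrow> bool"
  where "self_similar_closure X S \<longleftrightarrow>
    self_similar S \<and> l_subalgebra X S \<and>
    carrier S = \<Inter>{M. submonoid M (ss_monoid S) \<and> carrier X \<subseteq> M}"

text \<open>The two clauses defining the operation of \<open>SY\<close> on \<open>SX\<close> induced by \<open>\<rho>\<close>. They determine
  \<open>\<rho>'\<close> on the carriers when \<open>SX\<close> and \<open>SY\<close> are self-similar closures of \<open>X\<close> and \<open>Y\<close>.\<close>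

definition closure_operation ::
    "('a, 'k) lalgebra_scheme \<Rightarrow> ('a, 'l) lalgebra_scheme \<Rightarrow>
     ('b, 'm) lalgebra_scheme \<Rightarrow> ('b, 'n) lalgebra_scheme \<Rightarrow>
     ('b \<Rightarrow> 'a \<Rightarrow> 'a) \<Rightarrow> ('b \<Rightarrow> 'a \<Rightarrow> 'a) \<Rightarrow> bool"
  where "closure_operation X SX Y SY \<rho> \<rho>' \<longleftrightarrow>
    (\<forall>u\<in>carrier Y. \<rho>' u \<in> l_End SX \<and> (\<forall>x\<in>carrier X. \<rho>' u x = \<rho> u x)) \<and>
    (\<forall>a\<in>carrier SY. \<forall>b\<in>carrier SY. \<forall>x\<in>carrier SX.
       \<rho>' (ss_mult SY a b) x = \<rho>' a (\<rho>' b x))"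

end

theory Submission
  imports Defs
begin

text \<open>In a self-similar L-algebra \<open>(a \<cdot> b) a\<close> is the meet of \<open>a\<close> and \<open>b\<close>, so
  \<open>(a \<cdot> b) a = (b \<cdot> a) b\<close>; applying the multiplicative map \<open>\<rho>'\<close> to this identity is exactly the
  axiom of an operation. The semidirect product is then an L-algebra, and its self-similarity is
  witnessed by the explicit product \<open>(z, w) (x, u) = (z \<rho>'\<^sub>w(x), w u)\<close>. In particular
  \<open>(z, w) = (z, 1) (1, w)\<close>, which reduces generation to the two factors.\<close>

section \<open>Elimination and simplification rules for the basic notions\<close>

lemma l_EndD:
  assumes "f \<in> l_End X"
  shows l_End_closed: "x \<in> carrier X \<Longrightarrow> f x \<in> carrier X"
    and l_End_lop: "x \<in> carrier X \<Longrightarrow> y \<in> carrier X \<Longrightarrow> f (x \<cdot>\<^bsub>X\<^esub> y) = f x \<cdot>\<^bsub>X\<^esub> f y"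
  using assms by (auto simp: l_End_def)

lemma operates_onD:
  assumes "operates_on Y X \<rho>"
  shows operates_on_End: "u \<in> carrier Y \<Longrightarrow> \<rho> u \<in> l_End X"
    and operates_on_one: "x \<in> carrier X \<Longrightarrow> \<rho> \<^bold>1\<^bsub>Y\<^esub> x = x"
    and operates_on_swap: "u \<in> carrier Y \<Longrightarrow> v \<in> carrier Y \<Longrightarrow> x \<in> carrier X \<Longrightarrow>
      \<rho> (u \<cdot>\<^bsub>Y\<^esub> v) (\<rho> u x) = \<rho> (v \<cdot>\<^bsub>Y\<^esub> u) (\<rho> v x)"
  using assms by (auto simp: operates_on_def)

lemma semidirect_simps [simp]:
  "carrier (semidirect X \<rho> Y) = carrier X \<times> carrier Y"
  "(x, u) \<cdot>\<^bsub>semidirect X \<rho> Y\<^esub> (y, v) =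
    (\<rho> (u \<cdot>\<^bsub>Y\<^esub> v) x \<cdot>\<^bsub>X\<^esub> \<rho> (v \<cdot>\<^bsub>Y\<^esub> u) y, u \<cdot>\<^bsub>Y\<^esub> v)"
  "\<^bold>1\<^bsub>semidirect X \<rho> Y\<^esub> = (\<^bold>1\<^bsub>X\<^esub>, \<^bold>1\<^bsub>Y\<^esub>)"
  by (simp_all add: semidirect_def)

lemma ss_monoid_simps [simp]:
  "carrier (ss_monoid H) = carrier H"
  "a \<otimes>\<^bsub>ss_monoid H\<^esub> b = ss_mult H a b"
  "\<one>\<^bsub>ss_monoid H\<^esub> = \<^bold>1\<^bsub>H\<^esub>"
  by (simp_all add: ss_monoid_def)

section \<open>Semidirect products of L-algebras\<close>

context l_algebra
begin

lemma l_le_trans: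
  assumes "x \<in> carrier X" "y \<in> carrier X" "z \<in> carrier X" "x \<preceq> y" "y \<preceq> z"
  shows "x \<preceq> z"
proof -
  have "(x \<cdot> y) \<cdot> (x \<cdot> z) = (y \<cdot> x) \<cdot> (y \<cdot> z)"
    using assms by (simp add: cycloid)
  then show ?thesis
    using assms by (simp add: l_le_def lone_left lone_right lop_closed)
qed

lemma l_le_antisym:
  "x \<in> carrier X \<Longrightarrow> y \<in> carrier X \<Longrightarrow> x \<preceq> y \<Longrightarrow> y \<preceq> x \<Longrightarrow> x = y"
  unfolding l_le_def by (rule lop_antisym)

text \<open>\<open>l_End\<close> only demands compatibility with the operation; the unit is then
  fixed because \<open>1 = 1 \<cdot> 1\<close> gives \<open>f 1 = f 1 \<cdot> f 1\<close>, which is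
  \<open>1\<close>.\<close>

lemma l_End_one: "f \<in> l_End X \<Longrightarrow> f \<^bold>1 = \<^bold>1"
  using l_End_lop[of f X "\<^bold>1" "\<^bold>1"] l_End_closed[of f X "\<^bold>1"]
  by (simp add: lone_closed lop_self)

text \<open>Only the cycloid law takes work. In the second component it is the law of
  \<open>Y\<close>; in the first, the operation axiom lets each of \<open>x\<close>,
  \<open>y\<close>, \<open>z\<close> enter through a single image, and the law of \<open>X\<close>
  for these three images finishes.\<close>

lemma semidirect_l_algebra:
  assumes "l_algebra Y" and op: "operates_on Y X \<rho>"
  shows "l_algebra (semidirect X \<rho> Y)"
proof -
  interpret Y: l_algebra Y by fact
  let ?S = "semidirect X \<rho> Y"
  note End = operates_on_End[OF op] and swap = operates_on_swap[OF op]
  note cl = lop_closed Y.lop_closed l_End_closed[OF End]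
  note one = operates_on_one[OF op] l_End_one[OF End]
  have cyc: "((x, u) \<cdot>\<^bsub>?S\<^esub> (y, v)) \<cdot>\<^bsub>?S\<^esub> ((x, u) \<cdot>\<^bsub>?S\<^esub> (z, w)) =
      ((y, v) \<cdot>\<^bsub>?S\<^esub> (x, u)) \<cdot>\<^bsub>?S\<^esub> ((y, v) \<cdot>\<^bsub>?S\<^esub> (z, w))"
    if x: "x \<in> carrier X" "y \<in> carrier X" "z \<in> carrier X"
      and u: "u \<in> carrier Y" "v \<in> carrier Y" "w \<in> carrier Y"
    for x y z u v w
  proof -
    \<comment> \<open>\<open>p\<close> is the second component of both sides and acts on the first
      factor of each; \<open>q\<close> and \<open>r\<close> act on the second factor on the left and
      on the right. The cycloid law of \<open>Y\<close> supplies the alternative forms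
      \<open>p'\<close>, \<open>q'\<close>, \<open>r'\<close>.\<close>
    define p q r where "p = (u \<cdot>\<^bsub>Y\<^esub> v) \<cdot>\<^bsub>Y\<^esub> (u \<cdot>\<^bsub>Y\<^esub> w)"
      and "q = (u \<cdot>\<^bsub>Y\<^esub> w) \<cdot>\<^bsub>Y\<^esub> (u \<cdot>\<^bsub>Y\<^esub> v)"
      and "r = (v \<cdot>\<^bsub>Y\<^esub> w) \<cdot>\<^bsub>Y\<^esub> (v \<cdot>\<^bsub>Y\<^esub> u)"
    have pqr: "p \<in> carrier Y" "q \<in> carrier Y" "r \<in> carrier Y"
      using u by (simp_all add: p_def q_def r_def cl)
    have p': "p = (v \<cdot>\<^bsub>Y\<^esub> u) \<cdot>\<^bsub>Y\<^esub> (v \<cdot>\<^bsub>Y\<^esub> w)"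
      and q': "q = (w \<cdot>\<^bsub>Y\<^esub> u) \<cdot>\<^bsub>Y\<^esub> (w \<cdot>\<^bsub>Y\<^esub> v)"
      and r': "r = (w \<cdot>\<^bsub>Y\<^esub> v) \<cdot>\<^bsub>Y\<^esub> (w \<cdot>\<^bsub>Y\<^esub> u)"
      unfolding p_def q_def r_def using u by (blast intro: Y.cycloid)+
    \<comment> \<open>\<open>A\<close>, \<open>B\<close> and \<open>C\<close> identify the two
      images of \<open>x\<close>, of \<open>y\<close> and of \<open>z\<close> that occur in the
      law.\<close>
    have A: "\<rho> q (\<rho> (u \<cdot>\<^bsub>Y\<^esub> w) x) = \<rho> p (\<rho> (u \<cdot>\<^bsub>Y\<^esub> v) x)"
      unfolding p_def q_def by (rule swap) (use x u in \<open>simp_all add: cl\<close>)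
    have B: "\<rho> r (\<rho> (v \<cdot>\<^bsub>Y\<^esub> w) y) = \<rho> p (\<rho> (v \<cdot>\<^bsub>Y\<^esub> u) y)"
      unfolding p' r_def by (rule swap) (use x u in \<open>simp_all add: cl\<close>)
    have C: "\<rho> r (\<rho> (w \<cdot>\<^bsub>Y\<^esub> v) z) = \<rho> q (\<rho> (w \<cdot>\<^bsub>Y\<^esub> u) z)"
      unfolding q' r' by (rule swap) (use x u in \<open>simp_all add: cl\<close>)
    have "\<rho> p (\<rho> (u \<cdot>\<^bsub>Y\<^esub> v) x \<cdot> \<rho> (v \<cdot>\<^bsub>Y\<^esub> u) y) \<cdot>
        \<rho> q (\<rho> (u \<cdot>\<^bsub>Y\<^esub> w) x \<cdot> \<rho> (w \<cdot>\<^bsub>Y\<^esub> u) z) =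
      (\<rho> p (\<rho> (u \<cdot>\<^bsub>Y\<^esub> v) x) \<cdot> \<rho> p (\<rho> (v \<cdot>\<^bsub>Y\<^esub> u) y)) \<cdot>
        (\<rho> p (\<rho> (u \<cdot>\<^bsub>Y\<^esub> v) x) \<cdot> \<rho> q (\<rho> (w \<cdot>\<^bsub>Y\<^esub> u) z))"
      using x u pqr A by (simp add: l_End_lop[OF End] cl)
    also have "\<dots> = (\<rho> p (\<rho> (v \<cdot>\<^bsub>Y\<^esub> u) y) \<cdot> \<rho> p (\<rho> (u \<cdot>\<^bsub>Y\<^esub> v) x)) \<cdot>
        (\<rho> p (\<rho> (v \<cdot>\<^bsub>Y\<^esub> u) y) \<cdot> \<rho> q (\<rho> (w \<cdot>\<^bsub>Y\<^esub> u) z))"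
      using x u pqr by (intro cycloid) (simp_all add: cl)
    also have "\<dots> = \<rho> p (\<rho> (v \<cdot>\<^bsub>Y\<^esub> u) y \<cdot> \<rho> (u \<cdot>\<^bsub>Y\<^esub> v) x) \<cdot>
        \<rho> r (\<rho> (v \<cdot>\<^bsub>Y\<^esub> w) y \<cdot> \<rho> (w \<cdot>\<^bsub>Y\<^esub> v) z)"
      using x u pqr B C by (simp add: l_End_lop[OF End] cl)
    finally show ?thesis
      by (simp flip: p_def q_def r_def p')
  qed
  show ?thesis
  proof
    fix a b c
    assume abc: "a \<in> carrier ?S" "b \<in> carrier ?S" "c \<in> carrier ?S"
    obtain x u y v z w where eq: "a = (x, u)" "b = (y, v)" "c = (z, w)"
      by (metis prod.exhaust)
    show "(a \<cdot>\<^bsub>?S\<^esub> b) \<cdot>\<^bsub>?S\<^esub> (a \<cdot>\<^bsub>?S\<^esub> c) = (b \<cdot>\<^bsub>?S\<^esub> a) \<cdot>\<^bsub>?S\<^esub> (b \<cdot>\<^bsub>?S\<^esub> c)"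
      unfolding eq by (rule cyc) (use abc in \<open>simp_all add: eq\<close>)
  next
    fix a b
    assume ab: "a \<in> carrier ?S" "b \<in> carrier ?S"
      "a \<cdot>\<^bsub>?S\<^esub> b = \<^bold>1\<^bsub>?S\<^esub>" "b \<cdot>\<^bsub>?S\<^esub> a = \<^bold>1\<^bsub>?S\<^esub>"
    obtain x u y v where eq: "a = (x, u)" "b = (y, v)" by (metis prod.exhaust)
    have "u = v"
      by (rule Y.lop_antisym) (use ab in \<open>simp_all add: eq\<close>)
    \<comment> \<open>Once \<open>u = v\<close>, both actions are by \<open>u \<cdot> u = 1\<close>,
      hence trivial, and antisymmetry in \<open>X\<close> applies.\<close>
    moreover have "x = y"
      by (rule lop_antisym) (use ab \<open>u = v\<close> in \<open>simp_all add: eq Y.lop_self one\<close>)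
    ultimately show "a = b" by (simp add: eq)
  qed (auto simp: cl one lone_closed Y.lone_closed lone_left Y.lone_left lone_right
      Y.lone_right lop_self Y.lop_self)
qed

end

section \<open>Products and meets in a self-similar L-algebra\<close>

context self_similar
begin

text \<open>Surjectivity gives existence and injectivity uniqueness, so the description defining
  \<open>ss_mult\<close> denotes.\<close>

lemma ss_mult_unique:
  assumes "a \<in> carrier H" "b \<in> carrier H"
  shows "\<exists>!c. c \<in> carrier H \<and> c \<preceq> b \<and> b \<cdot> c = a"
proof -
  note bij = self_similar_bij[OF assms(2)]
  have "a \<in> (\<lambda>c. b \<cdot> c) ` {c \<in> carrier H. c \<preceq> b}"
    using assms(1) bij_betw_imp_surj_on[OF bij] by simp
  then show ?thesis
    using inj_onD[OF bij_betw_imp_inj_on[OF bij]] by auto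
qed

lemma
  assumes "a \<in> carrier H" "b \<in> carrier H"
  shows ss_mult_closed: "ss_mult H a b \<in> carrier H"
    and ss_mult_le: "ss_mult H a b \<preceq> b"
    and lop_ss_mult: "b \<cdot> ss_mult H a b = a"
  using theI'[OF ss_mult_unique[OF assms]] unfolding ss_mult_def by auto

lemma ss_mult_eqI:
  assumes "b \<in> carrier H" "c \<in> carrier H" "c \<preceq> b" "b \<cdot> c = a"
  shows "ss_mult H a b = c"
  unfolding ss_mult_def
  by (rule the1_equality[OF ss_mult_unique]) (use assms in \<open>auto simp: lop_closed\<close>)

text \<open>This is the cycloid law for \<open>b\<close>, the product \<open>ab\<close> and
  \<open>c\<close>, since \<open>b \<cdot> ab = a\<close> and
  \<open>ab \<cdot> b = 1\<close>.\<close>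

lemma ss_mult_lop:
  assumes "a \<in> carrier H" "b \<in> carrier H" "c \<in> carrier H"
  shows "ss_mult H a b \<cdot> c = a \<cdot> (b \<cdot> c)"
proof -
  have "(b \<cdot> ss_mult H a b) \<cdot> (b \<cdot> c) = (ss_mult H a b \<cdot> b) \<cdot> (ss_mult H a b \<cdot> c)"
    using assms by (intro cycloid) (simp_all add: ss_mult_closed)
  then show ?thesis
    using assms ss_mult_le[of a b]
    by (simp add: l_le_def lop_ss_mult lone_left lop_closed ss_mult_closed)
qed

text \<open>Residuation: right multiplication by \<open>b\<close> is left adjoint to
  \<open>b \<cdot> _\<close>.\<close>

lemma ss_mult_le_iff:
  assumes "a \<in> carrier H" "b \<in> carrier H" "c \<in> carrier H"
  shows "ss_mult H a b \<preceq> c \<longleftrightarrow> a \<preceq> b \<cdot> c"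
  using assms by (simp add: l_le_def ss_mult_lop)

text \<open>The universal property of the meet. For the converse direction,
  \<open>z \<preceq> a\<close> makes \<open>z\<close> the product of \<open>a \<cdot> z\<close> and
  \<open>a\<close>; residuation turns \<open>z \<preceq> b\<close> into
  \<open>a \<cdot> z \<preceq> a \<cdot> b\<close>, and multiplying by \<open>a\<close> on the right
  gives the bound.\<close>

lemma le_ss_mult_lop_iff:
  assumes "a \<in> carrier H" "b \<in> carrier H" "z \<in> carrier H"
  shows "z \<preceq> ss_mult H (a \<cdot> b) a \<longleftrightarrow> z \<preceq> a \<and> z \<preceq> b"
proof
  have "ss_mult H (a \<cdot> b) a \<preceq> a"
    using assms by (intro ss_mult_le lop_closed)
  moreover have "ss_mult H (a \<cdot> b) a \<preceq> b"
    using assms by (simp add: l_le_def ss_mult_lop lop_self lop_closed)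
  moreover assume "z \<preceq> ss_mult H (a \<cdot> b) a"
  moreover have "ss_mult H (a \<cdot> b) a \<in> carrier H"
    using assms by (intro ss_mult_closed lop_closed)
  ultimately show "z \<preceq> a \<and> z \<preceq> b"
    using assms l_le_trans by blast
next
  assume le: "z \<preceq> a \<and> z \<preceq> b"
  then have z: "ss_mult H (a \<cdot> z) a = z"
    using assms by (intro ss_mult_eqI) auto
  then have "a \<cdot> z \<preceq> a \<cdot> b"
    using le assms ss_mult_le_iff[of "a \<cdot> z" a b] by (simp add: lop_closed)
  then have "ss_mult H (a \<cdot> z) a \<preceq> ss_mult H (a \<cdot> b) a"
    using assms by (simp add: ss_mult_le_iff lop_ss_mult lop_closed ss_mult_closed)
  then show "z \<preceq> ss_mult H (a \<cdot> b) a" by (simp add: z)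
qed

text \<open>The lower bounds of the two products are described symmetrically in \<open>a\<close> and
  \<open>b\<close>, so each product lies below the other.\<close>

lemma ss_mult_lop_commute:
  assumes "a \<in> carrier H" "b \<in> carrier H"
  shows "ss_mult H (a \<cdot> b) a = ss_mult H (b \<cdot> a) b"
proof (rule l_le_antisym)
  have refl: "z \<preceq> z" if "z \<in> carrier H" for z
    using that by (simp add: l_le_def lop_self)
  show "ss_mult H (a \<cdot> b) a \<preceq> ss_mult H (b \<cdot> a) b"
    "ss_mult H (b \<cdot> a) b \<preceq> ss_mult H (a \<cdot> b) a"
    using assms le_ss_mult_lop_iff[of a b "ss_mult H (a \<cdot> b) a"]
      le_ss_mult_lop_iff[of b a "ss_mult H (b \<cdot> a) b"]
    by (simp_all add: le_ss_mult_lop_iff refl lop_closed ss_mult_closed)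
qed (use assms in \<open>simp_all add: lop_closed ss_mult_closed\<close>)

text \<open>The image of the product satisfies the two conditions that characterize the product of
  the images, because \<open>f\<close> preserves the operation and the unit.\<close>

lemma l_End_ss_mult:
  assumes f: "f \<in> l_End H" and "a \<in> carrier H" "b \<in> carrier H"
  shows "f (ss_mult H a b) = ss_mult H (f a) (f b)"
proof (rule ss_mult_eqI[symmetric])
  show "f (ss_mult H a b) \<preceq> f b"
    using assms ss_mult_le[of a b]
    by (simp add: l_le_def l_End_one ss_mult_closed flip: l_End_lop[OF f])
qed (use assms in \<open>simp_all add: l_End_closed ss_mult_closed lop_ss_mult flip: l_End_lop[OF f]\<close>)

lemma ss_mult_one_left: "b \<in> carrier H \<Longrightarrow> ss_mult H \<^bold>1 b = b"
  by (intro ss_mult_eqI) (simp_all add: l_le_def lop_self)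

lemma ss_mult_one_right: "a \<in> carrier H \<Longrightarrow> ss_mult H a \<^bold>1 = a"
  by (intro ss_mult_eqI) (simp_all add: l_le_def lone_left lone_right lone_closed)

lemma submonoid_carrier: "submonoid (carrier H) (ss_monoid H)"
  by (rule submonoid.intro) (simp_all add: ss_mult_closed lone_closed)

section \<open>Self-similarity of the semidirect product\<close>

lemma
  assumes "self_similar Y" and op: "operates_on Y H \<rho>"
  shows semidirect_self_similar: "self_similar (semidirect H \<rho> Y)"
    and semidirect_ss_mult: "z \<in> carrier H \<Longrightarrow> x \<in> carrier H \<Longrightarrow> w \<in> carrier Y \<Longrightarrow> u \<in> carrier Y \<Longrightarrow>
      ss_mult (semidirect H \<rho> Y) (z, w) (x, u) = (ss_mult H z (\<rho> w x), ss_mult Y w u)"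
proof -
  interpret Y: self_similar Y by fact
  let ?S = "semidirect H \<rho> Y"
  interpret S: l_algebra ?S
    by (rule semidirect_l_algebra[OF Y.l_algebra_axioms op])
  note one = operates_on_one[OF op]
  \<comment> \<open>Below \<open>(x, u)\<close> one has \<open>v \<cdot> u = 1\<close>, so the
    action on \<open>y\<close> is trivial and drops out of both formulas.\<close>
  have le: "(y, v) \<preceq>\<^bsub>?S\<^esub> (x, u) \<longleftrightarrow> v \<preceq>\<^bsub>Y\<^esub> u \<and> y \<preceq> \<rho> (u \<cdot>\<^bsub>Y\<^esub> v) x"
    and lop: "v \<preceq>\<^bsub>Y\<^esub> u \<Longrightarrow> (x, u) \<cdot>\<^bsub>?S\<^esub> (y, v) = (\<rho> (u \<cdot>\<^bsub>Y\<^esub> v) x \<cdot> y, u \<cdot>\<^bsub>Y\<^esub> v)"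
    if "x \<in> carrier H" "y \<in> carrier H" for x y u v
    using that by (auto simp: l_le_def one)
  \<comment> \<open>With \<open>u \<cdot> v = w\<close>, the conditions on \<open>v\<close> say that
    it is the product \<open>w u\<close>, and those on \<open>y\<close> say that it is the product
    of \<open>z\<close> and \<open>\<rho> w x\<close>. Both conclusions are read off here: the
    unique solution gives the bijection, and its value gives the product formula.\<close>
  have fib: "b \<in> carrier ?S \<and> b \<preceq>\<^bsub>?S\<^esub> (x, u) \<and> (x, u) \<cdot>\<^bsub>?S\<^esub> b = (z, w) \<longleftrightarrow>
      b = (ss_mult H z (\<rho> w x), ss_mult Y w u)" (is "?L b \<longleftrightarrow> b = ?p")
    if mem: "z \<in> carrier H" "x \<in> carrier H" "w \<in> carrier Y" "u \<in> carrier Y" for z x w u b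
  proof
    have wx: "\<rho> w x \<in> carrier H"
      using mem l_End_closed[OF operates_on_End[OF op]] by blast
    show "?L b" if "b = ?p"
      using that mem wx
      by (simp add: le lop ss_mult_closed Y.ss_mult_closed ss_mult_le Y.ss_mult_le
          lop_ss_mult Y.lop_ss_mult del: semidirect_simps(2))
    assume L: "?L b"
    obtain y v where b: "b = (y, v)" by (cases b)
    from L mem have y: "y \<in> carrier H" "v \<in> carrier Y" by (simp_all add: b)
    with L mem have v: "v \<preceq>\<^bsub>Y\<^esub> u" and le': "y \<preceq> \<rho> (u \<cdot>\<^bsub>Y\<^esub> v) x"
      by (auto simp: b le)
    with L mem y have w: "u \<cdot>\<^bsub>Y\<^esub> v = w" and "\<rho> w x \<cdot> y = z"
      by (auto simp: b lop simp del: semidirect_simps(2))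
    with v le' y mem wx show "b = ?p"
      by (simp add: b ss_mult_eqI Y.ss_mult_eqI)
  qed
  show ss: "self_similar ?S"
  proof
    fix a assume a: "a \<in> carrier ?S"
    obtain x u where xu: "a = (x, u)" by (cases a)
    have ex1: "\<exists>!b. b \<in> carrier ?S \<and> b \<preceq>\<^bsub>?S\<^esub> a \<and> a \<cdot>\<^bsub>?S\<^esub> b = c" if "c \<in> carrier ?S" for c
    proof -
      obtain z w where "c = (z, w)" by (cases c)
      then show ?thesis using that a by (simp only: xu) (subst fib; simp)
    qed
    show "bij_betw (\<lambda>b. a \<cdot>\<^bsub>?S\<^esub> b) {b \<in> carrier ?S. b \<preceq>\<^bsub>?S\<^esub> a} (carrier ?S)"
    proof (rule bij_betw_imageI)
      show "inj_on (\<lambda>b. a \<cdot>\<^bsub>?S\<^esub> b) {b \<in> carrier ?S. b \<preceq>\<^bsub>?S\<^esub> a}"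
      proof (rule inj_onI)
        fix b c
        assume b: "b \<in> {b \<in> carrier ?S. b \<preceq>\<^bsub>?S\<^esub> a}" and c: "c \<in> {b \<in> carrier ?S. b \<preceq>\<^bsub>?S\<^esub> a}"
          and eq: "a \<cdot>\<^bsub>?S\<^esub> b = a \<cdot>\<^bsub>?S\<^esub> c"
        from c have "a \<cdot>\<^bsub>?S\<^esub> c \<in> carrier ?S" by (intro S.lop_closed[OF a]) blast
        from ex1[OF this] show "b = c"
          by (rule ex1E) (use b c eq in blast)
      qed
      show "(\<lambda>b. a \<cdot>\<^bsub>?S\<^esub> b) ` {b \<in> carrier ?S. b \<preceq>\<^bsub>?S\<^esub> a} = carrier ?S"
      proof (rule equalityI)
        show "carrier ?S \<subseteq> (\<lambda>b. a \<cdot>\<^bsub>?S\<^esub> b) ` {b \<in> carrier ?S. b \<preceq>\<^bsub>?S\<^esub> a}"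
          by (rule subsetI, drule ex1, elim ex1E conjE, rule image_eqI, erule sym) simp
      qed (use S.lop_closed[OF a] in blast)
    qed
  qed
  show "ss_mult ?S (z, w) (x, u) = (ss_mult H z (\<rho> w x), ss_mult Y w u)"
    if "z \<in> carrier H" "x \<in> carrier H" "w \<in> carrier Y" "u \<in> carrier Y"
    unfolding ss_mult_def[of ?S] by (subst fib[OF that]) simp
qed

end

section \<open>Generation by the subalgebra, and the extended operation\<close>

lemma self_similar_closureD:
  assumes "self_similar_closure X S"
  shows self_similar_closure_self_similar: "self_similar S"
    and self_similar_closure_l_subalgebra: "l_subalgebra X S"
  using assms by (simp_all add: self_similar_closure_def)

text \<open>The elements satisfying \<open>P\<close> form a submonoid containing \<open>X\<close>,
  hence contain the intersection of all of these.\<close>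

lemma self_similar_closure_induct [consumes 2, case_names gen one mult]:
  assumes closure: "self_similar_closure X S" and a: "a \<in> carrier S"
    and gen: "\<And>x. x \<in> carrier X \<Longrightarrow> P x" and one: "P \<^bold>1\<^bsub>S\<^esub>"
    and mult: "\<And>a b. a \<in> carrier S \<Longrightarrow> b \<in> carrier S \<Longrightarrow> P a \<Longrightarrow> P b \<Longrightarrow> P (ss_mult S a b)"
  shows "P a"
proof -
  interpret self_similar S by (rule self_similar_closure_self_similar[OF closure])
  have "submonoid {a \<in> carrier S. P a} (ss_monoid S)"
    using one mult by unfold_locales (auto simp: ss_mult_closed lone_closed)
  moreover have "carrier X \<subseteq> {a \<in> carrier S. P a}"
    using closure gen by (auto simp: self_similar_closure_def l_subalgebra_def)
  ultimately have "carrier S \<subseteq> {a \<in> carrier S. P a}"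
    using closure unfolding self_similar_closure_def by blast
  with a show ?thesis by blast
qed

text \<open>The carrier is itself a submonoid containing \<open>X\<close>, which settles one
  inclusion; \<open>gen\<close> is the other.\<close>

lemma self_similar_closureI:
  assumes "self_similar S" and "l_subalgebra X S"
    and gen: "\<And>M a. submonoid M (ss_monoid S) \<Longrightarrow> carrier X \<subseteq> M \<Longrightarrow> a \<in> carrier S \<Longrightarrow> a \<in> M"
  shows "self_similar_closure X S"
  using assms self_similar.submonoid_carrier[of S]
  by (auto simp: self_similar_closure_def l_subalgebra_def)

lemma closure_operation_operates_on:
  assumes op: "operates_on Y X \<rho>"
    and SX: "self_similar_closure X SX" and SY: "self_similar_closure Y SY"
    and cl: "closure_operation X SX Y SY \<rho> \<rho>'"
  shows "operates_on SY SX \<rho>'"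
proof -
  interpret SX: self_similar SX by (rule self_similar_closure_self_similar[OF SX])
  interpret SY: self_similar SY by (rule self_similar_closure_self_similar[OF SY])
  have one: "\<^bold>1\<^bsub>Y\<^esub> = \<^bold>1\<^bsub>SY\<^esub>" "\<^bold>1\<^bsub>Y\<^esub> \<in> carrier Y"
    using self_similar_closure_l_subalgebra[OF SY]
    unfolding l_subalgebra_def by (blast intro: l_algebra.lone_closed)+
  have gen: "\<rho>' u \<in> l_End SX" if "u \<in> carrier Y" for u
    using cl that by (simp add: closure_operation_def)
  have \<rho>'_mult: "\<rho>' (ss_mult SY a b) x = \<rho>' a (\<rho>' b x)"
    if "a \<in> carrier SY" "b \<in> carrier SY" "x \<in> carrier SX" for a b x
    using cl that by (simp add: closure_operation_def)
  \<comment> \<open>The unit of \<open>SY\<close> is the unit of \<open>Y\<close>, so the clause on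
    generators covers it.\<close>
  have End1: "\<rho>' \<^bold>1\<^bsub>SY\<^esub> \<in> l_End SX"
    using gen one by metis
  \<comment> \<open>Products in \<open>SY\<close> act as composites, and composites of endomorphisms
    are endomorphisms.\<close>
  have End: "\<rho>' a \<in> l_End SX" if "a \<in> carrier SY" for a
    using SY that
  proof (induction rule: self_similar_closure_induct)
    case (mult a b)
    then show ?case
      by (auto simp: l_End_def Pi_iff SX.lop_closed \<rho>'_mult)
  qed (use gen End1 in auto)
  \<comment> \<open>On \<open>X\<close> this is the unit axiom for \<open>\<rho>\<close>; it spreads
    to \<open>SX\<close> because endomorphisms are multiplicative.\<close>
  have id: "\<rho>' \<^bold>1\<^bsub>SY\<^esub> x = x" if "x \<in> carrier SX" for x
    using SX that
  proof (induction rule: self_similar_closure_induct)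
    case (gen x)
    then show ?case
      using cl op one by (metis closure_operation_def operates_on_one)
  qed (simp_all add: SX.l_End_one[OF End1] SX.l_End_ss_mult[OF End1])
  \<comment> \<open>Each side is the action of a single product, and the two products are the same
    meet of \<open>u\<close> and \<open>v\<close>.\<close>
  have "\<rho>' (u \<cdot>\<^bsub>SY\<^esub> v) (\<rho>' u x) = \<rho>' (v \<cdot>\<^bsub>SY\<^esub> u) (\<rho>' v x)"
    if "u \<in> carrier SY" "v \<in> carrier SY" "x \<in> carrier SX" for u v x
    using that SY.ss_mult_lop_commute[of u v] by (simp add: SY.lop_closed flip: \<rho>'_mult)
  with End id show ?thesis
    by (simp add: operates_on_def)
qed

section \<open>The closure of the semidirect product\<close>

theorem theorem2p4:
  fixes X SX :: "'a lalgebra" and Y SY :: "'b lalgebra"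
    and \<rho> \<rho>' :: "'b \<Rightarrow> 'a \<Rightarrow> 'a"
  assumes "l_algebra X" and "l_algebra Y"
    and "operates_on Y X \<rho>"
    and "self_similar_closure X SX" and "self_similar_closure Y SY"
    and "closure_operation X SX Y SY \<rho> \<rho>'"
  shows "self_similar_closure (semidirect X \<rho> Y) (semidirect SX \<rho>' SY)"
proof -
  interpret X: l_algebra X by fact
  interpret Y: l_algebra Y by fact
  interpret SX: self_similar SX
    by (rule self_similar_closure_self_similar) fact
  interpret SY: self_similar SY
    by (rule self_similar_closure_self_similar) fact
  have op: "operates_on SY SX \<rho>'"
    by (rule closure_operation_operates_on) fact+
  let ?S = "semidirect SX \<rho>' SY"
  note ss = SX.semidirect_self_similar[OF SY.self_similar_axioms op]
  note S_mult = SX.semidirect_ss_mult[OF SY.self_similar_axioms op]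
  note S_one = operates_on_one[OF op] SX.l_End_one[OF operates_on_End[OF op]]
  have subX: "carrier X \<subseteq> carrier SX" "\<^bold>1\<^bsub>X\<^esub> = \<^bold>1\<^bsub>SX\<^esub>"
      "\<And>x y. x \<in> carrier X \<Longrightarrow> y \<in> carrier X \<Longrightarrow> x \<cdot>\<^bsub>X\<^esub> y = x \<cdot>\<^bsub>SX\<^esub> y"
    and subY: "carrier Y \<subseteq> carrier SY" "\<^bold>1\<^bsub>Y\<^esub> = \<^bold>1\<^bsub>SY\<^esub>"
      "\<And>u v. u \<in> carrier Y \<Longrightarrow> v \<in> carrier Y \<Longrightarrow> u \<cdot>\<^bsub>Y\<^esub> v = u \<cdot>\<^bsub>SY\<^esub> v"
    using assms(4,5) by (auto simp: self_similar_closure_def l_subalgebra_def)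
  have ext: "\<rho>' u x = \<rho> u x" if "u \<in> carrier Y" "x \<in> carrier X" for u x
    using assms(6) that by (simp add: closure_operation_def)
  have act: "\<rho> u x \<in> carrier X" if "u \<in> carrier Y" "x \<in> carrier X" for u x
    using that by (rule l_End_closed[OF operates_on_End[OF assms(3)]])
  show ?thesis
  proof (rule self_similar_closureI)
    show "self_similar ?S" by (rule ss)
    show "l_subalgebra (semidirect X \<rho> Y) ?S"
      unfolding l_subalgebra_def
    proof (intro conjI ballI)
      show "l_algebra (semidirect X \<rho> Y)"
        by (rule X.semidirect_l_algebra) fact+
      show "l_algebra ?S" using ss by (rule self_similar.axioms)
      \<comment> \<open>The operations agree because \<open>\<rho>'\<close> extends
        \<open>\<rho>\<close> and \<open>\<rho>\<close> keeps \<open>X\<close> invariant, so every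
        term is computed inside \<open>X\<close> and \<open>Y\<close>.\<close>
      fix a b assume "a \<in> carrier (semidirect X \<rho> Y)" "b \<in> carrier (semidirect X \<rho> Y)"
      then show "a \<cdot>\<^bsub>semidirect X \<rho> Y\<^esub> b = a \<cdot>\<^bsub>?S\<^esub> b"
        by (cases a; cases b) (simp add: ext act Y.lop_closed flip: subX(3) subY(3))
    qed (use subX subY in auto)
    fix M a
    assume M: "submonoid M (ss_monoid ?S)" and gen: "carrier (semidirect X \<rho> Y) \<subseteq> M"
      and a: "a \<in> carrier ?S"
    interpret M: submonoid M "ss_monoid ?S" by (rule M)
    obtain z w where zw: "a = (z, w)" "z \<in> carrier SX" "w \<in> carrier SY"
      using a by (cases a) auto
    note genM = subsetD[OF gen]
    \<comment> \<open>This slice is closed since \<open>(x, 1) (y, 1) = (x y, 1)\<close>, as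
      \<open>\<rho>' 1\<close> is the identity.\<close>
    have "(z, \<^bold>1\<^bsub>SY\<^esub>) \<in> M"
      using assms(4) zw(2)
    proof (induction rule: self_similar_closure_induct)
      case (gen x)
      then show ?case using Y.lone_closed subY(2) by (intro genM) simp
    next
      case one
      then show ?case using M.one_closed by simp
    next
      case (mult x y)
      then show ?case
        using M.m_closed[OF mult.IH]
        by (simp add: S_mult S_one SY.lone_closed SY.ss_mult_one_left)
    qed
    \<comment> \<open>Here \<open>(1, u) (1, v) = (1, u v)\<close>, as \<open>\<rho>' u\<close>
      fixes the unit.\<close>
    moreover have "(\<^bold>1\<^bsub>SX\<^esub>, w) \<in> M"
      using assms(5) zw(3)
    proof (induction rule: self_similar_closure_induct)
      case (gen u)
      then show ?case using X.lone_closed subX(2) by (intro genM) simp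
    next
      case one
      then show ?case using M.one_closed by simp
    next
      case (mult u v)
      then show ?case
        using M.m_closed[OF mult.IH]
        by (simp add: S_mult S_one SX.lone_closed SX.ss_mult_one_left)
    qed
    ultimately show "a \<in> M"
      using zw M.m_closed[of "(z, \<^bold>1\<^bsub>SY\<^esub>)" "(\<^bold>1\<^bsub>SX\<^esub>, w)"]
      by (simp add: S_mult S_one SX.lone_closed SY.lone_closed SX.ss_mult_one_right SY.ss_mult_one_left)
  qed
qed

end
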